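(* Let $(\kappa, k_1, k_2) \in \mathcal{L}_1^1$, i.e. let $\kappa, k_1, k_2 \in C_{-1}(0,+\infty)$ satisfy $(\kappa * k_1 * k_2)(t) = 1$ for all $t>0$. Then the 1st level general fractional derivative ${}_{1L}\mathbb{D}_{(k_1,k_2)}$ is a left inverse operator to the general fractional integral $\mathbb{I}_{(\kappa)}$ on the space $C_{-1,(k_1)}(0,+\infty)$: for every $f \in C_{-1,(k_1)}(0,+\infty)$, $$({}_{1L}\mathbb{D}_{(k_1,k_2)}\, \mathbb{I}_{(\kappa)}\, f)(t) = f(t), \qquad t>0.$$
   Context: Functions are real-valued and defined on $(0,+\infty)$. The space $C_{-1}(0,+\infty)$ is $$C_{-1}(0,+\infty) := \{f:\ f(t)=t^{p}f_1(t)\ \text{for } t>0,\ \text{for some } p>-1 \text{ and } f_1\in C[0,+\infty)\}.$$ The Laplace convolution is $(f*g)(t) = \int_0^t f(t-\tau)\,g(\tau)\,d\tau$, $t>0$. It is commutative and associative on $C_{-1}(0,+\infty)$ and maps pairs of functions of this space into this space. For $\kappa \in C_{-1}(0,+\infty)$, the general fractional integral (GFI) with kernel $\kappa$ is $$(\mathbb{I}_{(\kappa)}\, f)(t) := (\kappa * f)(t) = \int_0^t \kappa(t-\tau) f(\tau)\,d\tau,\quad t>0,$$ and likewise $\mathbb{I}_{(k_1)} f = k_1 * f$, $\mathbb{I}_{(k_2)} f = k_2 * f$. $\mathcal{L}_1^1$ denotes the set of triples $(\kappa,k_1,k_2)$ of functions in $C_{-1}(0,+\infty)$ such that $(\kappa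 * k_1 * k_2)(t) = 1$ for all $t>0$ (the 1st level kernels). For $(\kappa,k_1,k_2)\in\mathcal{L}_1^1$, the 1st level general fractional derivative (GFD) is $$({}_{1L}\mathbb{D}_{(k_1,k_2)}\, f)(t) := \left(\mathbb{I}_{(k_1)}\, \frac{d}{dt}\, \mathbb{I}_{(k_2)}\, f\right)(t),\quad t>0.$$ The space $C_{-1,(k_1)}(0,+\infty)$ is $$C_{-1,(k_1)}(0,+\infty) := \{f:\ f(t) = (\mathbb{I}_{(k_1)}\,\phi)(t)\ \text{for } t>0,\ \text{for some } \phi\in C_{-1}(0,+\infty)\}.$$ *)

theory Defs
  imports "HOL-Analysis.Analysis"
begin

text \<open>
  Functions on \<open>(0,+\<infinity>)\<close> are rendered as functions of type \<^typ>\<open>real \<Rightarrow> real\<close>.  Their values at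
  nonpositive arguments are irrelevant: membership in the spaces below only constrains \<open>t > 0\<close>,
  and convolutions are integrals over the open interval \<open>(0,t)\<close>.
\<close>

definition C_minus1 :: "(real \<Rightarrow> real) set" where
  "C_minus1 = {f. \<exists>p f1. p > -1 \<and> continuous_on {0..} f1 \<and> (\<forall>t>0. f t = t powr p * f1 t)}"

definition laplace_conv :: "(real \<Rightarrow> real) \<Rightarrow> (real \<Rightarrow> real) \<Rightarrow> real \<Rightarrow> real"  (infixl "\<star>" 70) where
  "(f \<star> g) t = (LBINT \<tau>:{0<..<t}. f (t - \<tau>) * g \<tau>)"

text \<open>Existence of the integral defining \<open>(f \<star> g) t\<close>; otherwise that integral is \<open>0\<close> by convention.\<close>

definition conv_exists :: "(real \<Rightarrow> real) \<Rightarrow> (real \<Rightarrow> real) \<Rightarrow> real \<Rightarrow> bool" where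
  "conv_exists f g t \<longleftrightarrow> set_integrable lborel {0<..<t} (\<lambda>\<tau>. f (t - \<tau>) * g \<tau>)"

definition GFI :: "(real \<Rightarrow> real) \<Rightarrow> (real \<Rightarrow> real) \<Rightarrow> real \<Rightarrow> real" where
  "GFI \<kappa> f = \<kappa> \<star> f"

definition first_level_kernels :: "((real \<Rightarrow> real) \<times> (real \<Rightarrow> real) \<times> (real \<Rightarrow> real)) set" where
  "first_level_kernels =
     {(\<kappa>, k1, k2). \<kappa> \<in> C_minus1 \<and> k1 \<in> C_minus1 \<and> k2 \<in> C_minus1 \<and>
        (\<forall>t>0. (\<kappa> \<star> k1 \<star> k2) t = 1)}"

definition GFD1 :: "(real \<Rightarrow> real) \<Rightarrow> (real \<Rightarrow> real) \<Rightarrow> (real \<Rightarrow> real) \<Rightarrow> real \<Rightarrow> real" where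
  "GFD1 k1 k2 f = GFI k1 (deriv (GFI k2 f))"

text \<open>
  Since \<^const>\<open>deriv\<close> and the integral are total, the assertion that the expression defining
  \<open>GFD1 k1 k2 f t\<close> is meaningful has to be made separately.
\<close>

definition GFD1_exists :: "(real \<Rightarrow> real) \<Rightarrow> (real \<Rightarrow> real) \<Rightarrow> (real \<Rightarrow> real) \<Rightarrow> real \<Rightarrow> bool" where
  "GFD1_exists k1 k2 f t \<longleftrightarrow>
     (\<forall>s. 0 < s \<and> s < t \<longrightarrow> conv_exists k2 f s \<and> GFI k2 f field_differentiable (at s)) \<and>
     conv_exists k1 (deriv (GFI k2 f)) t"

definition C_minus1_kernel :: "(real \<Rightarrow> real) \<Rightarrow> (real \<Rightarrow> real) set" where
  "C_minus1_kernel k = {f. \<exists>\<phi>\<in>C_minus1. \<forall>t>0. f t = GFI k \<phi> t}"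

end

theory Submission
  imports Defs
begin

text \<open>
  Write a function of the kernel space as \<open>f = k\<^sub>1 \<star> \<phi>\<close>.  Commutativity and associativity of the
  Laplace convolution give
  \<open>k\<^sub>2 \<star> (\<kappa> \<star> f) = (\<kappa> \<star> k\<^sub>1 \<star> k\<^sub>2) \<star> \<phi> = 1 \<star> \<phi>\<close>,
  which is the antiderivative of \<open>\<phi>\<close> vanishing at \<open>0\<close>.  As \<open>\<phi>\<close> is continuous on the open half-line
  (though possibly singular at \<open>0\<close>), differentiating gives back \<open>\<phi>\<close>, and a final convolution with
  \<open>k\<^sub>1\<close> gives back \<open>f\<close>.

  The analytic content is that all these convolutions exist at every \<open>t > 0\<close>, not merely almost
  everywhere, and that they may be re-associated.  Both become easy on the class
  \<open>locally_power_bounded\<close> of Borel functions that are dominated on each \<open>(0,T]\<close> by a multiple of an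
  integrable power.  This class contains \<^const>\<open>C_minus1\<close>, and the Beta integral shows that it is
  closed under convolution (\<open>locally_power_bounded_laplace_conv\<close>); its members need not
  be continuous, so that only measurability and a bound have to be carried through.  Associativity
  (\<open>laplace_conv_assoc\<close>) is then Fubini's theorem, whose hypothesis holds because
  \<open>\<bar>f\<bar> \<star> (\<bar>g\<bar> \<star> \<bar>h\<bar>)\<close> exists.
\<close>

section \<open>Convolution as an integral over the whole line\<close>

text \<open>
  Cutting both factors off at \<open>0\<close> removes the dependence of the domain of integration on \<open>t\<close>, so
  that translations and Fubini's theorem on the plane apply directly.
\<close>

definition causal :: "(real \<Rightarrow> real) \<Rightarrow> real \<Rightarrow> real" where
  "causal f t = indicator {0<..} t * f t"

lemma causal_conv_integrand:
  "causal f (t - \<tau>) * causal g \<tau> = indicator {0<..<t} \<tau> *\<^sub>R (f (t - \<tau>) * g \<tau>)"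
  by (auto simp: causal_def indicator_def)

lemma laplace_conv_causal:
  "(f \<star> g) t = (\<integral>\<tau>. causal f (t - \<tau>) * causal g \<tau> \<partial>lborel)"
  by (simp add: laplace_conv_def set_lebesgue_integral_def causal_conv_integrand)

lemma conv_exists_causal:
  "conv_exists f g t \<longleftrightarrow> integrable lborel (\<lambda>\<tau>. causal f (t - \<tau>) * causal g \<tau>)"
  by (simp add: conv_exists_def set_integrable_def causal_conv_integrand)

lemma laplace_conv_nonpos: "t \<le> 0 \<Longrightarrow> (f \<star> g) t = 0"
  by (simp add: laplace_conv_def set_lebesgue_integral_def)

lemma causal_laplace_conv: "causal (f \<star> g) = f \<star> g"
  by (rule ext) (auto simp: causal_def indicator_def laplace_conv_nonpos)

lemma causal_abs: "causal (\<lambda>t. \<bar>f t\<bar>) t = \<bar>causal f t\<bar>"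
  by (simp add: causal_def indicator_def)

lemma causal_cong: "(\<And>t. t > 0 \<Longrightarrow> f t = g t) \<Longrightarrow> causal f = causal g"
  by (rule ext) (auto simp: causal_def indicator_def)

lemma laplace_conv_cong:
  assumes "\<And>t. t > 0 \<Longrightarrow> f t = f' t" "\<And>t. t > 0 \<Longrightarrow> g t = g' t"
  shows "f \<star> g = f' \<star> g'"
  using causal_cong[of f f'] causal_cong[of g g'] assms
  by (intro ext) (simp add: laplace_conv_causal)

lemma conv_exists_cong:
  assumes "\<And>t. t > 0 \<Longrightarrow> f t = f' t" "\<And>t. t > 0 \<Longrightarrow> g t = g' t"
  shows "conv_exists f g t \<longleftrightarrow> conv_exists f' g' t"
  using causal_cong[of f f'] causal_cong[of g g'] assms
  by (simp add: conv_exists_causal)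

lemma laplace_conv_commute: "f \<star> g = g \<star> f"
proof
  fix t
  show "(f \<star> g) t = (g \<star> f) t"
    unfolding laplace_conv_causal
    by (subst lborel_integral_real_affine[where c = "-1" and t = t]) (simp_all add: mult.commute)
qed

section \<open>Functions dominated by integrable powers\<close>

definition locally_power_bounded :: "(real \<Rightarrow> real) set" where
  "locally_power_bounded = {f. causal f \<in> borel_measurable borel \<and>
     (\<forall>T>0. \<exists>p>-1. \<exists>M. \<forall>t\<in>{0<..T}. \<bar>f t\<bar> \<le> M * t powr p)}"

lemma causal_measurable:
  "f \<in> locally_power_bounded \<Longrightarrow> causal f \<in> borel_measurable borel"
  by (simp add: locally_power_bounded_def)

lemma locally_power_boundedE:
  assumes "f \<in> locally_power_bounded" "T > 0"
  obtains p M where "p > -1" "M \<ge> 0" "\<And>t. t \<in> {0<..T} \<Longrightarrow> \<bar>f t\<bar> \<le> M * t powr p"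
proof -
  from assms obtain p M where *: "p > -1" "\<And>t. t \<in> {0<..T} \<Longrightarrow> \<bar>f t\<bar> \<le> M * t powr p"
    unfolding locally_power_bounded_def by blast
  have "0 \<le> M * T powr p"
    using *(2)[of T] assms(2) by (intro order_trans[OF abs_ge_zero]) auto
  hence "M \<ge> 0"
    using assms(2) by (simp add: zero_le_mult_iff)
  with * show ?thesis
    by (intro that)
qed

lemma locally_power_bounded_abs:
  assumes "f \<in> locally_power_bounded"
  shows "(\<lambda>t. \<bar>f t\<bar>) \<in> locally_power_bounded"
proof -
  have "causal (\<lambda>t. \<bar>f t\<bar>) = (\<lambda>t. \<bar>causal f t\<bar>)"
    by (simp add: causal_abs fun_eq_iff)
  thus ?thesis
    using assms by (auto simp: locally_power_bounded_def intro: borel_measurable_abs)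
qed

lemma locally_power_bounded_cong:
  assumes "f \<in> locally_power_bounded" "\<And>t. t > 0 \<Longrightarrow> f t = g t"
  shows "g \<in> locally_power_bounded"
  using assms causal_cong[of f g] by (auto simp: locally_power_bounded_def)

lemma C_minus1_continuous_on:
  assumes "f \<in> C_minus1"
  shows "continuous_on {0<..} f"
proof -
  from assms obtain p f1 where f: "continuous_on {0..} f1" "\<And>t. t > 0 \<Longrightarrow> f t = t powr p * f1 t"
    by (auto simp: C_minus1_def)
  have "continuous_on {0<..} (\<lambda>t. t powr p * f1 t)"
    by (intro continuous_intros continuous_on_subset[OF f(1)]) auto
  thus ?thesis
    by (rule continuous_on_eq) (simp add: f(2))
qed

lemma C_minus1_locally_power_bounded:
  assumes "f \<in> C_minus1"
  shows "f \<in> locally_power_bounded"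
proof -
  from assms obtain p f1 where f: "p > -1" "continuous_on {0..} f1"
      "\<And>t. t > 0 \<Longrightarrow> f t = t powr p * f1 t"
    by (auto simp: C_minus1_def)
  have "\<exists>M. \<forall>t\<in>{0<..T}. \<bar>f t\<bar> \<le> M * t powr p" for T
  proof -
    have "compact (f1 ` {0..T})"
      by (intro compact_continuous_image continuous_on_subset[OF f(2)]) auto
    then obtain M where M: "\<And>t. t \<in> {0..T} \<Longrightarrow> \<bar>f1 t\<bar> \<le> M"
      by (meson bounded_real compact_imp_bounded imageI)
    have "\<bar>f t\<bar> \<le> M * t powr p" if "t \<in> {0<..T}" for t
      using that M[of t] f(3)[of t] by (simp add: abs_mult mult.commute[of M] mult_left_mono)
    thus ?thesis by blast
  qed
  moreover have "causal f \<in> borel_measurable borel"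
    using borel_measurable_continuous_on_indicator[OF _ C_minus1_continuous_on[OF assms]]
    unfolding causal_def by simp
  ultimately show ?thesis
    using f(1) by (auto simp: locally_power_bounded_def)
qed

text \<open>
  The substitution \<open>\<tau> = t x\<close> reduces the convolution of two powers to the Beta integral, whose
  value is the constant \<open>B\<close>.
\<close>

lemma conv_powr_has_integral:
  fixes p q :: real
  assumes "p > -1" "q > -1"
  obtains B where "\<And>t. t > 0 \<Longrightarrow>
    has_bochner_integral lborel (\<lambda>\<tau>. indicator {0<..<t} \<tau> * ((t - \<tau>) powr p * \<tau> powr q))
      (B * t powr (p + q + 1))"
proof -
  define g where "g x = indicator {0<..<1} x * ((1 - x) powr p * x powr q)" for x :: real
  have "set_integrable lborel {0..1} (\<lambda>x. x powr ((q + 1) - 1) * (1 - x) powr ((p + 1) - 1))"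
    using assms by (intro integrable_Beta) auto
  hence "set_integrable lborel {0..1} (\<lambda>x. x powr q * (1 - x) powr p)"
    by simp
  hence "set_integrable lborel {0<..<1} (\<lambda>x. x powr q * (1 - x) powr p)"
    by (rule set_integrable_subset) auto
  hence g: "integrable lborel g"
    by (simp add: set_integrable_def g_def[abs_def] mult_ac)
  show ?thesis
  proof (rule that)
    fix t :: real assume t: "t > 0"
    define h where "h \<tau> = indicator {0<..<t} \<tau> * ((t - \<tau>) powr p * \<tau> powr q)" for \<tau>
    have scale: "h (0 + t * x) = t powr (p + q) * g x" for x
    proof (cases "x \<in> {0<..<1}")
      case True
      have "(t - t * x) powr p = t powr p * (1 - x) powr p"
        using t True by (subst powr_mult[symmetric]) (auto simp: algebra_simps)
      thus ?thesis
        using t True by (simp add: h_def g_def powr_mult powr_add indicator_def)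
    next
      case False
      thus ?thesis
        using t by (auto simp: h_def g_def indicator_def zero_less_mult_iff)
    qed
    have "integrable lborel (\<lambda>x. h (0 + t * x))"
      using g by (simp only: scale integrable_mult_right)
    hence "integrable lborel h"
      using t by (subst (asm) lborel_integrable_real_affine_iff) auto
    moreover have "integral\<^sup>L lborel h = t * (t powr (p + q) * integral\<^sup>L lborel g)"
      using t by (subst lborel_integral_real_affine[where c = t and t = 0])
        (simp_all only: scale integral_mult_right_zero, simp)
    ultimately show "has_bochner_integral lborel
        (\<lambda>\<tau>. indicator {0<..<t} \<tau> * ((t - \<tau>) powr p * \<tau> powr q))
        (integral\<^sup>L lborel g * t powr (p + q + 1))"
      using t by (simp add: has_bochner_integral_iff h_def[abs_def] powr_add)
  qed
qed

text \<open>
  On \<open>(0,t)\<close> the integrand is dominated by a multiple of \<open>(t - \<tau>) powr p * \<tau> powr q\<close>, so the Beta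
  integral gives both existence and a bound.  The new exponent \<open>p + q + 1\<close> again exceeds \<open>-1\<close>, which
  is what makes the class closed under convolution.
\<close>

lemma laplace_conv_dominated:
  assumes f: "f \<in> locally_power_bounded" and g: "g \<in> locally_power_bounded" and "T > 0"
  obtains p M where "p > -1" "\<And>t. t \<in> {0<..T} \<Longrightarrow> conv_exists f g t"
    "\<And>t. t \<in> {0<..T} \<Longrightarrow> \<bar>(f \<star> g) t\<bar> \<le> M * t powr p"
proof -
  note [measurable] = causal_measurable[OF f] causal_measurable[OF g]
  obtain p M where p: "p > -1" and M: "M \<ge> 0" "\<And>t. t \<in> {0<..T} \<Longrightarrow> \<bar>f t\<bar> \<le> M * t powr p"
    using locally_power_boundedE[OF f \<open>T > 0\<close>] by metis
  obtain q N where q: "q > -1" and N: "N \<ge> 0" "\<And>t. t \<in> {0<..T} \<Longrightarrow> \<bar>g t\<bar> \<le> N * t powr q"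
    using locally_power_boundedE[OF g \<open>T > 0\<close>] by metis
  obtain B where B: "\<And>t. t > 0 \<Longrightarrow>
      has_bochner_integral lborel (\<lambda>\<tau>. indicator {0<..<t} \<tau> * ((t - \<tau>) powr p * \<tau> powr q))
        (B * t powr (p + q + 1))"
    using conv_powr_has_integral[OF p q] by blast
  define w where "w t \<tau> = M * N * (indicator {0<..<t} \<tau> * ((t - \<tau>) powr p * \<tau> powr q))" for t \<tau>
  have w: "has_bochner_integral lborel (w t) (M * N * (B * t powr (p + q + 1)))" if "t > 0" for t
    unfolding w_def by (intro has_bochner_integral_mult_right B that)
  have le: "\<bar>causal f (t - \<tau>) * causal g \<tau>\<bar> \<le> w t \<tau>" if t: "t \<in> {0<..T}" for t \<tau>
  proof (cases "\<tau> \<in> {0<..<t}")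
    case True
    have "\<bar>f (t - \<tau>)\<bar> * \<bar>g \<tau>\<bar> \<le> (M * (t - \<tau>) powr p) * (N * \<tau> powr q)"
      using t True M N by (intro mult_mono) auto
    thus ?thesis
      using True by (simp add: w_def causal_def abs_mult mult_ac)
  qed (auto simp: w_def causal_def indicator_def)
  have ex: "conv_exists f g t" if t: "t \<in> {0<..T}" for t
    unfolding conv_exists_causal
  proof (rule Bochner_Integration.integrable_bound)
    show "integrable lborel (w t)"
      using w[of t] t by (auto simp: has_bochner_integral_iff)
    show "AE \<tau> in lborel. norm (causal f (t - \<tau>) * causal g \<tau>) \<le> norm (w t \<tau>)"
      using le[OF t] by (intro AE_I2) (simp add: order_trans[OF _ abs_ge_self])
  qed measurable
  have "\<bar>(f \<star> g) t\<bar> \<le> (M * N * B) * t powr (p + q + 1)" if t: "t \<in> {0<..T}" for t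
  proof -
    have "\<bar>(f \<star> g) t\<bar> \<le> (\<integral>\<tau>. \<bar>causal f (t - \<tau>) * causal g \<tau>\<bar> \<partial>lborel)"
      unfolding laplace_conv_causal by (rule integral_abs_bound)
    also have "\<dots> \<le> integral\<^sup>L lborel (w t)"
      using ex[OF t] w[of t] t le[OF t]
      by (intro integral_mono) (auto simp: conv_exists_causal has_bochner_integral_iff)
    finally show ?thesis
      using w[of t] t by (simp add: has_bochner_integral_iff mult.assoc)
  qed
  with ex p q show ?thesis
    by (intro that[of "p + q + 1" "M * N * B"]) auto
qed

lemma conv_exists_locally_power_bounded:
  assumes "f \<in> locally_power_bounded" "g \<in> locally_power_bounded"
  shows "conv_exists f g t"
proof (cases "t > 0")
  case True
  then show ?thesis
    using laplace_conv_dominated[OF assms True] by (metis greaterThanAtMost_iff order_refl)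
qed (simp add: conv_exists_def)

lemma locally_power_bounded_laplace_conv:
  assumes f: "f \<in> locally_power_bounded" and g: "g \<in> locally_power_bounded"
  shows "f \<star> g \<in> locally_power_bounded"
proof -
  note [measurable] = causal_measurable[OF f] causal_measurable[OF g]
  have "(\<lambda>t. \<integral>\<tau>. causal f (t - \<tau>) * causal g \<tau> \<partial>lborel) \<in> borel_measurable borel"
    by measurable
  hence "causal (f \<star> g) \<in> borel_measurable borel"
    by (subst causal_laplace_conv) (simp add: laplace_conv_causal[abs_def])
  moreover have "\<exists>p>-1. \<exists>M. \<forall>t\<in>{0<..T}. \<bar>(f \<star> g) t\<bar> \<le> M * t powr p" if "T > 0" for T
    using laplace_conv_dominated[OF f g that] by metis
  ultimately show ?thesis
    by (simp add: locally_power_bounded_def)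
qed

section \<open>Associativity\<close>

text \<open>
  After a translation of the inner variable, both sides are iterated integrals of
  \<open>f (t - \<tau>) * g (\<tau> - s) * h s\<close> over the plane.
\<close>

lemma laplace_conv_assoc:
  assumes f: "f \<in> locally_power_bounded" and g: "g \<in> locally_power_bounded"
    and h: "h \<in> locally_power_bounded"
  shows "f \<star> g \<star> h = f \<star> (g \<star> h)"
proof
  fix t
  note [measurable] = causal_measurable[OF f] causal_measurable[OF g] causal_measurable[OF h]
  define F where "F \<tau> s = causal f (t - \<tau>) * (causal g (\<tau> - s) * causal h s)" for \<tau> s
  have gh: "integrable lborel (\<lambda>s. causal g (\<tau> - s) * causal h s)" for \<tau>
    using conv_exists_locally_power_bounded[OF g h] by (simp add: conv_exists_causal)
  have "integrable (lborel \<Otimes>\<^sub>M lborel) (case_prod F)"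
  proof (rule lborel_pair.Fubini_integrable)
    show "case_prod F \<in> borel_measurable (lborel \<Otimes>\<^sub>M lborel)"
      unfolding F_def by measurable
    have "(\<integral>s. norm (F \<tau> s) \<partial>lborel)
        = causal (\<lambda>x. \<bar>f x\<bar>) (t - \<tau>) * causal ((\<lambda>x. \<bar>g x\<bar>) \<star> (\<lambda>x. \<bar>h x\<bar>)) \<tau>" for \<tau>
      by (simp add: F_def abs_mult causal_laplace_conv laplace_conv_causal causal_abs)
    moreover have "conv_exists (\<lambda>x. \<bar>f x\<bar>) ((\<lambda>x. \<bar>g x\<bar>) \<star> (\<lambda>x. \<bar>h x\<bar>)) t"
      by (intro conv_exists_locally_power_bounded locally_power_bounded_laplace_conv
          locally_power_bounded_abs f g h)
    ultimately show "integrable lborel (\<lambda>\<tau>. \<integral>s. norm (case_prod F (\<tau>, s)) \<partial>lborel)"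
      by (simp add: conv_exists_causal)
    show "AE \<tau> in lborel. integrable lborel (\<lambda>s. case_prod F (\<tau>, s))"
      using gh by (simp add: F_def)
  qed
  hence swap: "(\<integral>s. (\<integral>\<tau>. F \<tau> s \<partial>lborel) \<partial>lborel) = (\<integral>\<tau>. (\<integral>s. F \<tau> s \<partial>lborel) \<partial>lborel)"
    by (rule lborel_pair.Fubini_integral)
  have inner: "(f \<star> g) (t - s) = (\<integral>\<tau>. causal f (t - \<tau>) * causal g (\<tau> - s) \<partial>lborel)" for s
    unfolding laplace_conv_causal
    by (subst lborel_integral_real_affine[where c = 1 and t = "-s"]) simp_all
  have "(f \<star> g \<star> h) t = (\<integral>s. (\<integral>\<tau>. F \<tau> s \<partial>lborel) \<partial>lborel)"
    by (simp add: laplace_conv_causal[of "f \<star> g"] causal_laplace_conv inner F_def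
        flip: mult.assoc)
  also have "\<dots> = (f \<star> (g \<star> h)) t"
    unfolding swap
    by (simp add: laplace_conv_causal[of f] causal_laplace_conv laplace_conv_causal[of g]
        F_def[abs_def])
  finally show "(f \<star> g \<star> h) t = (f \<star> (g \<star> h)) t" .
qed

section \<open>Differentiating the convolution with the constant one\<close>

text \<open>
  Since \<open>\<phi>\<close> may be unbounded at \<open>0\<close>, the fundamental theorem is used in its local form: \<open>\<phi>\<close> is
  integrable near \<open>0\<close> and continuous at the point \<open>s\<close>.
\<close>

lemma laplace_conv_one_has_derivative:
  assumes \<phi>: "\<phi> \<in> C_minus1" and "s > 0"
  shows "((\<lambda>t. ((\<lambda>_. 1) \<star> \<phi>) t) has_real_derivative \<phi> s) (at s)"
proof -
  have "(\<lambda>_. 1) \<in> C_minus1"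
    unfolding C_minus1_def by (auto intro!: exI[of _ "0::real"] exI[of _ "\<lambda>_. 1::real"])
  hence int: "set_integrable lborel {0<..<t} \<phi>" for t
    using conv_exists_locally_power_bounded[of "\<lambda>_. 1" \<phi> t] \<phi>
    by (simp add: C_minus1_locally_power_bounded conv_exists_def)
  have eq: "((\<lambda>_. 1) \<star> \<phi>) t = integral {0..t} \<phi>" for t
    using set_borel_integral_eq_integral(2)[OF int[of t]]
    by (simp add: laplace_conv_def integral_open_interval_real)
  have "((\<lambda>t. integral {0..t} \<phi>) has_vector_derivative \<phi> s) (at s within ({0..s + 1} - {}))"
  proof (rule integral_has_vector_derivative_continuous_at)
    show "\<phi> integrable_on {0..s + 1}"
      using set_borel_integral_eq_integral(1)[OF int] by (simp add: integrable_on_Icc_iff_Ioo)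
    have "isCont \<phi> s"
      using C_minus1_continuous_on[OF \<phi>] \<open>s > 0\<close> by (simp add: continuous_on_eq_continuous_at)
    thus "continuous (at s within ({0..s + 1} - {})) \<phi>"
      by (rule continuous_at_imp_continuous_at_within)
  qed (use \<open>s > 0\<close> in auto)
  moreover have "at s within ({0..s + 1} - {}) = at s"
    using \<open>s > 0\<close> by (intro at_within_interior) simp
  ultimately show ?thesis
    by (simp add: eq has_real_derivative_iff_has_vector_derivative)
qed

section \<open>The left inverse property\<close>

theorem theorem3p1:
  fixes \<kappa> k1 k2 :: "real \<Rightarrow> real"
  assumes "(\<kappa>, k1, k2) \<in> first_level_kernels"
  shows "\<forall>f \<in> C_minus1_kernel k1. \<forall>t>0.
           conv_exists \<kappa> f t \<and> GFD1_exists k1 k2 (GFI \<kappa> f) t \<and>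
           GFD1 k1 k2 (GFI \<kappa> f) t = f t"
proof (intro ballI allI impI)
  fix f and t :: real assume "f \<in> C_minus1_kernel k1" "t > 0"
  then obtain \<phi> where \<phi>: "\<phi> \<in> C_minus1" and f: "\<And>t. t > 0 \<Longrightarrow> f t = (k1 \<star> \<phi>) t"
    by (auto simp: C_minus1_kernel_def GFI_def)
  from assms have one: "\<And>t. t > 0 \<Longrightarrow> (\<kappa> \<star> k1 \<star> k2) t = 1"
    and "\<kappa> \<in> C_minus1" "k1 \<in> C_minus1" "k2 \<in> C_minus1"
    by (auto simp: first_level_kernels_def)
  note pb = this(2-4)[THEN C_minus1_locally_power_bounded] C_minus1_locally_power_bounded[OF \<phi>]
  note closed = locally_power_bounded_laplace_conv
  have fpb: "f \<in> locally_power_bounded"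
    using locally_power_bounded_cong[OF closed[OF pb(2,4)]] f by simp

  have "k2 \<star> (\<kappa> \<star> f) = k2 \<star> (\<kappa> \<star> (k1 \<star> \<phi>))"
    by (intro laplace_conv_cong fun_cong[OF laplace_conv_cong] f refl)
  also have "\<dots> = k2 \<star> (\<kappa> \<star> k1 \<star> \<phi>)"
    using pb by (simp add: laplace_conv_assoc)
  also have "\<dots> = k2 \<star> (\<kappa> \<star> k1) \<star> \<phi>"
    using pb by (simp add: laplace_conv_assoc closed)
  also have "\<dots> = \<kappa> \<star> k1 \<star> k2 \<star> \<phi>"
    by (simp add: laplace_conv_commute[of k2])
  also have "\<dots> = (\<lambda>_. 1) \<star> \<phi>"
    by (intro laplace_conv_cong one refl)
  finally have conv: "k2 \<star> (\<kappa> \<star> f) = (\<lambda>_. 1) \<star> \<phi>" .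

  have der: "(GFI k2 (GFI \<kappa> f) has_real_derivative \<phi> s) (at s)" if "s > 0" for s
    using laplace_conv_one_has_derivative[OF \<phi> that] by (simp add: GFI_def conv)
  hence deriv: "deriv (GFI k2 (GFI \<kappa> f)) s = \<phi> s" if "s > 0" for s
    using that by (blast intro: DERIV_imp_deriv)
  have "GFD1_exists k1 k2 (GFI \<kappa> f) t"
    unfolding GFD1_exists_def
  proof (intro conjI allI impI)
    show "conv_exists k1 (deriv (GFI k2 (GFI \<kappa> f))) t"
      using conv_exists_locally_power_bounded[OF pb(2,4), of t] deriv
      by (subst conv_exists_cong[where f' = k1 and g' = \<phi>]) auto
    fix s assume s: "0 < s \<and> s < t"
    show "conv_exists k2 (GFI \<kappa> f) s"
      unfolding GFI_def by (intro conv_exists_locally_power_bounded closed pb fpb)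
    show "GFI k2 (GFI \<kappa> f) field_differentiable at s"
      using der[of s] s by (auto simp: field_differentiable_def)
  qed
  moreover have "GFD1 k1 k2 (GFI \<kappa> f) = k1 \<star> \<phi>"
    unfolding GFD1_def by (subst GFI_def, intro laplace_conv_cong deriv refl)
  ultimately show "conv_exists \<kappa> f t \<and> GFD1_exists k1 k2 (GFI \<kappa> f) t \<and>
      GFD1 k1 k2 (GFI \<kappa> f) t = f t"
    using conv_exists_locally_power_bounded[OF pb(1) fpb] f[OF \<open>t > 0\<close>] by simp
qed

end
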